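(* Let $n\ge 1$, let $\mu$ be a probability measure on $\{-1,1\}^n$ with full support (i.e. $\mu(\bm z)>0$ for every $\bm z\in\{-1,1\}^n$), let $\psi:\{-1,1\}^n\to\mathbb{R}$ be any function, and let $\mathcal{E}$ be a set of two-element subsets of $[n]=\{1,\dots,n\}$. Let $\Phi=\{\emptyset\}\cup\{\{i\}:i\in[n]\}\cup\mathcal{E}=\{S_1,\dots,S_K\}$ with $K=|\Phi|$, and let $\mathcal{L}_{\mathcal{E}}=\mathrm{span}\{\chi_S:S\in\Phi\}$. Define $G\in\mathbb{R}^{K\times K}$ and $\bm c\in\mathbb{R}^K$ by $G_{i,j}=\langle\chi_{S_i},\chi_{S_j}\rangle_\mu$ and $\bm c_i=\langle\psi,\chi_{S_i}\rangle_\mu$. Then the minimization problem $$\min_{\phi\in\mathcal{L}_{\mathcal{E}}}\|\psi-\phi\|_\mu^2$$ has a unique minimizer $\hat\psi_{\mathcal{E}}$, and it is given by $$\hat\psi_{\mathcal{E}}(\bm z)=\sum_{i=1}^K\hat{\bm\theta}_i\,\chi_{S_i}(\bm z),$$ where $\hat{\bm\theta}\in\mathbb{R}^K$ is the unique solution of the normal equations $G\hat{\bm\theta}=\bm c$. In particular, if $\psi\in\mathcal{L}_{\mathcal{E}}$, then $\hat\psi_{\mathcal{E}}=\psi$.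
   Context: For $S\subseteq[n]$, the Walsh character $\chi_S:\{-1,1\}^n\to\mathbb{R}$ is $\chi_S(\bm z)=\prod_{i\in S}\bm z_i$ (with $\chi_\emptyset=1$). For functions $\psi,\phi:\{-1,1\}^n\to\mathbb{R}$, $\langle\psi,\phi\rangle_\mu=\mathbb{E}_{\bm z\sim\mu}[\psi(\bm z)\phi(\bm z)]=\sum_{\bm z}\mu(\bm z)\psi(\bm z)\phi(\bm z)$, and $\|\psi\|_\mu^2=\langle\psi,\psi\rangle_\mu$. *)

theory Defs
  imports
    "HOL-Probability.Probability"
    "HOL-Library.Function_Algebras"
    "Jordan_Normal_Form.Matrix"
begin

text \<open>
  The symbol \<open>$\<close> and the type name \<open>vec\<close> are those of \<^theory>\<open>Jordan_Normal_Form.Matrix\<close>,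
  whose entries are indexed from \<open>0\<close>.
\<close>

no_notation vec_nth (infixl \<open>$\<close> 90)


subsection \<open>The cube\<close>

typedef pm1 = "{-1, 1 :: real}"
  morphisms val_pm1 Abs_pm1
  by blast

instance pm1 :: finite
proof
  have "inj val_pm1" and "range val_pm1 \<subseteq> {-1, 1}"
    using val_pm1_inject val_pm1 by (auto simp: inj_def)
  then show "finite (UNIV :: pm1 set)"
    by (meson finite.intros finite_imageD finite_subset)
qed

text \<open>
  The index set \<open>[n]\<close> is a type \<open>'n\<close> of class \<^class>\<open>finite\<close>, so that \<open>n = CARD('n) \<ge> 1\<close>.
  Functions on \<open>'n cube\<close> are exactly the functions on \<open>{-1,1}\<^sup>n\<close>, with extensional equality.
\<close>

type_synonym 'n cube = "'n \<Rightarrow> pm1"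


subsection \<open>Pointwise real vector space structure on functions\<close>

instantiation "fun" :: (type, real_vector) real_vector
begin

definition scaleR_fun :: "real \<Rightarrow> ('a \<Rightarrow> 'b) \<Rightarrow> 'a \<Rightarrow> 'b" where
  "scaleR_fun c f = (\<lambda>x. c *\<^sub>R f x)"

instance
  by standard
    (simp_all add: scaleR_fun_def fun_eq_iff scaleR_add_right scaleR_add_left)

end


subsection \<open>Walsh characters and the inner product\<close>

definition walsh :: "'n::finite set \<Rightarrow> 'n cube \<Rightarrow> real" where
  "walsh S z = (\<Prod>i\<in>S. val_pm1 (z i))"

definition inner_mu ::
    "'n::finite cube pmf \<Rightarrow> ('n cube \<Rightarrow> real) \<Rightarrow> ('n cube \<Rightarrow> real) \<Rightarrow> real" where
  "inner_mu \<mu> \<psi> \<phi> = measure_pmf.expectation \<mu> (\<lambda>z. \<psi> z * \<phi> z)"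

lemma inner_mu_eq_sum: "inner_mu \<mu> \<psi> \<phi> = (\<Sum>z\<in>UNIV. pmf \<mu> z * \<psi> z * \<phi> z)"
  unfolding inner_mu_def
  by (subst integral_measure_pmf[of UNIV]) (simp_all add: mult.assoc)

definition norm2_mu :: "'n::finite cube pmf \<Rightarrow> ('n cube \<Rightarrow> real) \<Rightarrow> real" where
  "norm2_mu \<mu> \<psi> = inner_mu \<mu> \<psi> \<psi>"


subsection \<open>The approximation problem\<close>

definition feature_sets :: "'n::finite set set \<Rightarrow> 'n set set" where
  "feature_sets E = {{}} \<union> {{i} |i. True} \<union> E"

definition approx_space :: "'n::finite set set \<Rightarrow> ('n cube \<Rightarrow> real) set" where
  "approx_space E = span (walsh ` feature_sets E)"

definition is_best_approx ::
    "'n::finite cube pmf \<Rightarrow> 'n set set \<Rightarrow> ('n cube \<Rightarrow> real) \<Rightarrow> ('n cube \<Rightarrow> real) \<Rightarrow> bool" where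
  "is_best_approx \<mu> E \<psi> =
     is_arg_min (\<lambda>\<phi>. norm2_mu \<mu> (\<psi> - \<phi>)) (\<lambda>\<phi>. \<phi> \<in> approx_space E)"

definition gram :: "'n::finite cube pmf \<Rightarrow> (nat \<Rightarrow> 'n set) \<Rightarrow> nat \<Rightarrow> real mat" where
  "gram \<mu> S K = mat K K (\<lambda>(i, j). inner_mu \<mu> (walsh (S i)) (walsh (S j)))"

definition moments ::
    "'n::finite cube pmf \<Rightarrow> ('n cube \<Rightarrow> real) \<Rightarrow> (nat \<Rightarrow> 'n set) \<Rightarrow> nat \<Rightarrow> real vec" where
  "moments \<mu> \<psi> S K = vec K (\<lambda>i. inner_mu \<mu> \<psi> (walsh (S i)))"

end

theory Submission
  imports Defs "Jordan_Normal_Form.Determinant"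
begin

text \<open>
  The Walsh characters are orthogonal for the uniform measure, hence linearly independent. Since
  \<open>\<mu>\<close> has full support, \<open>\<theta>\<^sup>T G \<theta> = \<parallel>\<Sum>\<^sub>i \<theta>\<^sub>i \<chi>\<^bsub>S\<^sub>i\<^esub>\<parallel>\<^sup>2\<close> then forces \<open>G\<close> to be injective, so the normal
  equations have exactly one solution. They say that the residual is orthogonal to the
  approximation space, and Pythagoras gives optimality and uniqueness.
\<close>

lemma sum_val_pm1: "(\<Sum>b\<in>UNIV. val_pm1 b) = 0"
proof -
  have "range val_pm1 = {-1, 1}"
    by (rule type_definition.Rep_range[OF type_definition_pm1])
  moreover have "inj val_pm1"
    by (simp add: inj_def val_pm1_inject)
  ultimately have "(\<Sum>b\<in>UNIV. val_pm1 b) = \<Sum>{-1, 1 :: real}"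
    using sum.reindex[of val_pm1 UNIV "\<lambda>x. x"] by simp
  then show ?thesis by simp
qed

lemma val_pm1_mult_self: "val_pm1 b * val_pm1 b = 1"
  using val_pm1[of b] by auto

text \<open>The sum over the cube factorises into one sum per coordinate. A coordinate lying in
  exactly one of \<open>S\<close> and \<open>T\<close> contributes the factor (-1) + 1 = 0.\<close>

lemma sum_walsh_mult_eq_0:
  fixes S T :: "'n::finite set"
  assumes "S \<noteq> T"
  shows "(\<Sum>z\<in>UNIV. walsh S z * walsh T z) = 0"
proof -
  \<comment> \<open>\<open>f i b\<close> is the contribution of coordinate \<open>i\<close> with
    value \<open>b\<close> to the product of both characters. Padding with 1 makes every product
    range over all coordinates, as the distributive law \<open>prod_sum_PiE\<close>
    requires.\<close>
  define f :: "'n \<Rightarrow> pm1 \<Rightarrow> real"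
    where "f i b = (if i \<in> S then val_pm1 b else 1) * (if i \<in> T then val_pm1 b else 1)" for i b
  have walsh_UNIV: "walsh U z = (\<Prod>i\<in>UNIV. if i \<in> U then val_pm1 (z i) else 1)"
    for U :: "'n set" and z
    unfolding walsh_def by (simp add: prod.If_cases)
  obtain j where j: "j \<in> S \<longleftrightarrow> j \<notin> T"
    using assms by blast
  have "(\<Sum>z\<in>UNIV. walsh S z * walsh T z) = (\<Sum>z\<in>UNIV. \<Prod>i\<in>UNIV. f i (z i))"
    by (simp add: walsh_UNIV f_def prod.distrib)
  also have "\<dots> = (\<Prod>i\<in>UNIV. \<Sum>b\<in>UNIV. f i b)"
    using prod_sum_PiE[of UNIV "\<lambda>_. UNIV" f] by (simp add: PiE_UNIV_domain)
  also have "\<dots> = 0"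
  proof (rule prod_zero)
    show "\<exists>i\<in>UNIV. (\<Sum>b\<in>UNIV. f i b) = 0"
      using j by (intro bexI[of _ j]; cases "j \<in> T") (simp_all add: f_def sum_val_pm1)
  qed simp
  finally show ?thesis .
qed

lemma walsh_mult_self: "walsh S z * walsh S z = 1"
  by (simp add: walsh_def val_pm1_mult_self flip: prod.distrib)

text \<open>Summing the combination against the \<open>j\<close>-th character over the cube isolates
  \<open>c j\<close>, scaled by the size of the cube. The unweighted sum is used because the
  characters need not be orthogonal with respect to \<mu>.\<close>

lemma walsh_combination_eq_0:
  fixes S :: "'i \<Rightarrow> 'n::finite set"
  assumes "finite I" and inj: "inj_on S I" and zero: "\<And>z. (\<Sum>i\<in>I. c i * walsh (S i) z) = 0"
    and j: "j \<in> I"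
  shows "c j = 0"
proof -
  have "0 = (\<Sum>z\<in>UNIV. (\<Sum>i\<in>I. c i * walsh (S i) z) * walsh (S j) z)"
    using zero by simp
  also have "\<dots> = (\<Sum>i\<in>I. c i * (\<Sum>z\<in>UNIV. walsh (S i) z * walsh (S j) z))"
    unfolding sum_distrib_right sum_distrib_left by (subst sum.swap) (simp add: mult.assoc)
  also have "\<dots> = (\<Sum>i\<in>I. if i = j then c j * real CARD('n cube) else 0)"
  proof (rule sum.cong)
    fix i assume "i \<in> I"
    then show "c i * (\<Sum>z\<in>UNIV. walsh (S i) z * walsh (S j) z) =
      (if i = j then c j * real CARD('n cube) else 0)"
      using inj j by (auto simp: walsh_mult_self sum_walsh_mult_eq_0 inj_on_eq_iff)
  qed simp
  also have "\<dots> = c j * real CARD('n cube)"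
    using \<open>finite I\<close> j by simp
  finally show ?thesis by simp
qed

lemma inner_mu_commute: "inner_mu \<mu> f g = inner_mu \<mu> g f"
  by (simp add: inner_mu_eq_sum mult_ac)

lemma inner_mu_add_right: "inner_mu \<mu> f (g + h) = inner_mu \<mu> f g + inner_mu \<mu> f h"
  by (simp add: inner_mu_eq_sum distrib_left sum.distrib)

lemma inner_mu_add_left: "inner_mu \<mu> (f + g) h = inner_mu \<mu> f h + inner_mu \<mu> g h"
  by (simp add: inner_mu_eq_sum algebra_simps sum.distrib)

lemma inner_mu_diff_left: "inner_mu \<mu> (f - g) h = inner_mu \<mu> f h - inner_mu \<mu> g h"
  by (simp add: inner_mu_eq_sum algebra_simps sum_subtractf)

lemma inner_mu_scaleR_right: "inner_mu \<mu> f (c *\<^sub>R g) = c * inner_mu \<mu> f g"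
  by (simp add: inner_mu_eq_sum scaleR_fun_def sum_distrib_left mult_ac)

lemma inner_mu_zero_right: "inner_mu \<mu> f 0 = 0"
  by (simp add: inner_mu_eq_sum)

lemma inner_mu_combination_left:
  "inner_mu \<mu> (\<lambda>z. \<Sum>i\<in>I. c i * g i z) h = (\<Sum>i\<in>I. c i * inner_mu \<mu> (g i) h)"
  unfolding inner_mu_eq_sum sum_distrib_left sum_distrib_right
  by (subst sum.swap) (simp add: mult_ac)

lemma norm2_mu_nonneg: "norm2_mu \<mu> f \<ge> 0"
  by (simp add: norm2_mu_def inner_mu_eq_sum mult.assoc sum_nonneg)

text \<open>A vanishing sum of nonnegative terms has only zero terms, and full support lets the
  weight be cancelled at every point.\<close>

lemma norm2_mu_eq_0_imp:
  assumes full_support: "\<And>z. pmf \<mu> z > 0" and "norm2_mu \<mu> f = 0"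
  shows "f = 0"
proof
  fix z
  have "\<forall>z\<in>UNIV. pmf \<mu> z * (f z * f z) = 0"
    using assms(2) unfolding norm2_mu_def inner_mu_eq_sum
    by (subst (asm) sum_nonneg_eq_0_iff) (auto simp: mult.assoc)
  then have "pmf \<mu> z * (f z * f z) = 0"
    by blast
  then show "f z = 0 z"
    using full_support[of z] by simp
qed

lemma norm2_mu_add_orthogonal:
  assumes "inner_mu \<mu> f g = 0"
  shows "norm2_mu \<mu> (f + g) = norm2_mu \<mu> f + norm2_mu \<mu> g"
  using assms inner_mu_commute[of \<mu> g f]
  by (simp add: norm2_mu_def inner_mu_add_left inner_mu_add_right)

text \<open>The functions orthogonal to \<open>f\<close> form a subspace; as it contains
  \<open>B\<close>, it contains the span.\<close>

lemma inner_mu_span_eq_0: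
  assumes "\<And>b. b \<in> B \<Longrightarrow> inner_mu \<mu> f b = 0" and "g \<in> span B"
  shows "inner_mu \<mu> f g = 0"
proof -
  have "span B \<subseteq> {g. inner_mu \<mu> f g = 0}"
    using assms(1)
    by (intro span_minimal)
      (auto simp: subspace_def inner_mu_add_right inner_mu_scaleR_right inner_mu_zero_right)
  then show ?thesis
    using assms(2) by blast
qed

lemma combination_in_span:
  fixes c :: "'i \<Rightarrow> real" and g :: "'i \<Rightarrow> 'a \<Rightarrow> real"
  assumes "finite I" and "\<And>i. i \<in> I \<Longrightarrow> g i \<in> B"
  shows "(\<lambda>z. \<Sum>i\<in>I. c i * g i z) \<in> span B"
  using assms
proof (induction I)
  case empty
  then show ?case
    using span_zero[of B] by (simp add: zero_fun_def)
next
  case (insert i I)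
  have "(\<lambda>z. \<Sum>k\<in>insert i I. c k * g k z) = c i *\<^sub>R g i + (\<lambda>z. \<Sum>k\<in>I. c k * g k z)"
    using insert.hyps by (simp add: fun_eq_iff scaleR_fun_def)
  then show ?case
    using insert by (simp add: span_add span_scale span_base)
qed

text \<open>Reduces optimality and uniqueness together to finitely many orthogonality conditions,
  which the normal equations will supply.\<close>

lemma orthogonal_residual_best_approx:
  assumes full_support: "\<And>z. pmf \<mu> z > 0"
    and p: "p \<in> approx_space E"
    and orth: "\<And>T. T \<in> feature_sets E \<Longrightarrow> inner_mu \<mu> (\<psi> - p) (walsh T) = 0"
  shows "is_best_approx \<mu> E \<psi> \<phi> \<longleftrightarrow> \<phi> = p"
proof -
  \<comment> \<open>Split \<psi> - \<phi> as (\<psi> - p) + (p - \<phi>): the second summand stays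
    in the approximation space, hence is orthogonal to the residual.\<close>
  have pythagoras: "norm2_mu \<mu> (\<psi> - \<phi>) = norm2_mu \<mu> (\<psi> - p) + norm2_mu \<mu> (p - \<phi>)"
    if "\<phi> \<in> approx_space E" for \<phi>
  proof -
    have "p - \<phi> \<in> span (walsh ` feature_sets E)"
      using p that unfolding approx_space_def by (rule span_diff)
    then have "inner_mu \<mu> (\<psi> - p) (p - \<phi>) = 0"
      by (rule inner_mu_span_eq_0[rotated]) (use orth in auto)
    from norm2_mu_add_orthogonal[OF this] show ?thesis by simp
  qed
  have best: "is_best_approx \<mu> E \<psi> p"
    unfolding is_best_approx_def is_arg_min_linorder
  proof (intro conjI allI impI p)
    fix \<phi> assume "\<phi> \<in> approx_space E"
    from pythagoras[OF this] show "norm2_mu \<mu> (\<psi> - p) \<le> norm2_mu \<mu> (\<psi> - \<phi>)"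
      using norm2_mu_nonneg[of \<mu> "p - \<phi>"] by linarith
  qed
  have "\<phi> = p" if "is_best_approx \<mu> E \<psi> \<phi>"
  proof -
    have \<phi>: "\<phi> \<in> approx_space E" and le: "norm2_mu \<mu> (\<psi> - \<phi>) \<le> norm2_mu \<mu> (\<psi> - p)"
      using that p by (auto simp: is_best_approx_def is_arg_min_linorder)
    have "norm2_mu \<mu> (p - \<phi>) = 0"
      using pythagoras[OF \<phi>] le norm2_mu_nonneg[of \<mu> "p - \<phi>"] by linarith
    from norm2_mu_eq_0_imp[OF full_support this] show ?thesis by simp
  qed
  with best show ?thesis by blast
qed

lemma gram_carrier: "gram \<mu> S K \<in> carrier_mat K K"
  by (simp add: gram_def)

text \<open>Linearity of the inner product, together with its symmetry, turns row \<open>j\<close>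
  of the linear system into a statement about the function with coefficients \<theta>.\<close>

lemma gram_mult_vec:
  assumes "\<theta> \<in> carrier_vec K" and "j < K"
  shows "(gram \<mu> S K *\<^sub>v \<theta>) $ j =
    inner_mu \<mu> (\<lambda>z. \<Sum>i<K. \<theta> $ i * walsh (S i) z) (walsh (S j))"
  using assms
  by (auto simp: gram_def scalar_prod_def inner_mu_combination_left lessThan_atLeast0
      mult.commute intro!: sum.cong inner_mu_commute)

lemma gram_kernel:
  assumes full_support: "\<And>z. pmf \<mu> z > 0" and inj: "inj_on S {..<K}"
    and \<theta>: "\<theta> \<in> carrier_vec K" and zero: "gram \<mu> S K *\<^sub>v \<theta> = 0\<^sub>v K"
  shows "\<theta> = 0\<^sub>v K"
proof -
  let ?f = "\<lambda>z. \<Sum>i<K. \<theta> $ i * walsh (S i) z"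
  have "inner_mu \<mu> ?f (walsh (S j)) = 0" if "j < K" for j
    using gram_mult_vec[OF \<theta> that, of \<mu> S] zero that by simp
  \<comment> \<open>Expanding only the left factor of the squared norm leaves a combination of the
    inner products just shown to vanish.\<close>
  then have "norm2_mu \<mu> ?f = 0"
    unfolding norm2_mu_def
    by (subst inner_mu_combination_left) (simp add: inner_mu_commute[of \<mu> "walsh _"])
  from norm2_mu_eq_0_imp[OF full_support this] have "?f z = 0" for z
    by (simp add: fun_eq_iff)
  then have "\<theta> $ j = 0" if "j < K" for j
    using walsh_combination_eq_0[of "{..<K}" S "\<lambda>i. \<theta> $ i" j] inj that by simp
  then show ?thesis
    using \<theta> by auto
qed

text \<open>A square matrix with trivial kernel has nonzero determinant, hence a two-sided inverse
  \<open>B\<close>. The right inverse law gives existence, the left one uniqueness.\<close>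

lemma trivial_kernel_imp_ex1_solution:
  fixes A :: "'a::field mat"
  assumes A: "A \<in> carrier_mat n n" and b: "b \<in> carrier_vec n"
    and ker: "\<And>v. v \<in> carrier_vec n \<Longrightarrow> A *\<^sub>v v = 0\<^sub>v n \<Longrightarrow> v = 0\<^sub>v n"
  shows "\<exists>!v. v \<in> carrier_vec n \<and> A *\<^sub>v v = b"
proof -
  have "det A \<noteq> 0"
    using det_0_iff_vec_prod_zero_field[OF A] ker by blast
  \<comment> \<open>\<open>()\<close> instantiates the record extension of the matrix ring, whose
    units are the matrices with a two-sided inverse.\<close>
  from det_non_zero_imp_unit[OF A this, of "()"] obtain B
    where B: "B \<in> carrier_mat n n" and BA: "B * A = 1\<^sub>m n" and AB: "A * B = 1\<^sub>m n"
    by (auto simp: Units_def ring_mat_def)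
  show ?thesis
  proof (rule ex1I[of _ "B *\<^sub>v b"])
    show "B *\<^sub>v b \<in> carrier_vec n \<and> A *\<^sub>v (B *\<^sub>v b) = b"
      using A B b AB by (simp flip: assoc_mult_mat_vec)
    show "v = B *\<^sub>v b" if "v \<in> carrier_vec n \<and> A *\<^sub>v v = b" for v
      using that A B BA assoc_mult_mat_vec[OF B A, of v] by auto
  qed
qed

theorem mainTheorem1:
  fixes \<mu> :: "'n::finite cube pmf"
    and \<psi> :: "'n cube \<Rightarrow> real"
    and E :: "'n set set"
    and S :: "nat \<Rightarrow> 'n set"
    and K :: nat
  assumes full_support: "\<And>z. pmf \<mu> z > 0"
    and pairs: "\<And>e. e \<in> E \<Longrightarrow> card e = 2"
    and K: "K = card (feature_sets E)"
    and enum: "bij_betw S {..<K} (feature_sets E)"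
  shows "\<exists>\<psi>hat \<theta>hat.
           is_best_approx \<mu> E \<psi> \<psi>hat \<and>
           (\<forall>\<phi>. is_best_approx \<mu> E \<psi> \<phi> \<longrightarrow> \<phi> = \<psi>hat) \<and>
           \<theta>hat \<in> carrier_vec K \<and>
           gram \<mu> S K *\<^sub>v \<theta>hat = moments \<mu> \<psi> S K \<and>
           (\<forall>\<theta> \<in> carrier_vec K. gram \<mu> S K *\<^sub>v \<theta> = moments \<mu> \<psi> S K \<longrightarrow> \<theta> = \<theta>hat) \<and>
           (\<forall>z. \<psi>hat z = (\<Sum>i<K. \<theta>hat $ i * walsh (S i) z)) \<and>
           (\<psi> \<in> approx_space E \<longrightarrow> \<psi>hat = \<psi>)"
proof -
  have inj: "inj_on S {..<K}" and img: "S ` {..<K} = feature_sets E"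
    using enum by (auto simp: bij_betw_def)
  have "moments \<mu> \<psi> S K \<in> carrier_vec K"
    by (simp add: moments_def)
  then have "\<exists>!\<theta>. \<theta> \<in> carrier_vec K \<and> gram \<mu> S K *\<^sub>v \<theta> = moments \<mu> \<psi> S K"
    using gram_carrier gram_kernel[OF full_support inj]
    by (intro trivial_kernel_imp_ex1_solution)
  then obtain \<theta> where \<theta>: "\<theta> \<in> carrier_vec K"
    and normal: "gram \<mu> S K *\<^sub>v \<theta> = moments \<mu> \<psi> S K"
    and unique: "\<forall>\<theta>' \<in> carrier_vec K. gram \<mu> S K *\<^sub>v \<theta>' = moments \<mu> \<psi> S K \<longrightarrow> \<theta>' = \<theta>"
    by blast
  define p where "p = (\<lambda>z. \<Sum>i<K. \<theta> $ i * walsh (S i) z)"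
  have p: "p \<in> approx_space E"
    unfolding p_def approx_space_def using img by (intro combination_in_span) auto
  have "inner_mu \<mu> (\<psi> - p) (walsh T) = 0" if T: "T \<in> feature_sets E" for T
  proof -
    obtain j where j: "j < K" "T = S j"
      using T unfolding img[symmetric] by blast
    \<comment> \<open>Row \<open>j\<close> of the normal equations, read as orthogonality of the
      residual to the \<open>j\<close>-th character.\<close>
    have "inner_mu \<mu> p (walsh (S j)) = inner_mu \<mu> \<psi> (walsh (S j))"
      using gram_mult_vec[OF \<theta> j(1), of \<mu> S] normal j(1) by (simp add: p_def moments_def)
    then show ?thesis
      by (simp add: j inner_mu_diff_left)
  qed
  then have best: "is_best_approx \<mu> E \<psi> \<phi> \<longleftrightarrow> \<phi> = p" for \<phi>
    using full_support p by (intro orthogonal_residual_best_approx)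
  \<comment> \<open>Here \<psi> itself plays the part of the projection: its residual is 0, so the
    orthogonality conditions are trivial. Uniqueness then identifies it with
    \<open>p\<close>.\<close>
  moreover have "is_best_approx \<mu> E \<psi> \<psi>" if "\<psi> \<in> approx_space E"
    using that orthogonal_residual_best_approx[OF full_support that, of \<psi>]
    by (simp add: inner_mu_eq_sum)
  ultimately have "\<psi> \<in> approx_space E \<longrightarrow> p = \<psi>"
    by auto
  moreover have "\<forall>z. p z = (\<Sum>i<K. \<theta> $ i * walsh (S i) z)"
    by (simp add: p_def)
  ultimately show ?thesis
    using \<theta> normal unique
    by (intro exI[of _ p] exI[of _ \<theta>] conjI) (assumption | simp (no_asm) add: best)+
qed

end
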